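(* Suppose that $\{(G_i,c_i)\}_{i\in I}$ are circularly-ordered groups, $H$ is a group and for each $i\in I$, $\phi_i:H\to G_i$ is an injective homomorphism with image $H_i\subset G_i$. If there is a circular ordering $c$ on the free product with amalgamation $*_{i\in I}G_i\,(H_i\stackrel{\phi_i}{\cong}H)$ extending each of the $c_i$, then there exist cohomologically constant normal families $\mathcal{R}_i\subset\mathrm{CO}(G_i)$ such that $c_i\in\mathcal{R}_i$ for all $i\in I$ and the collections $\{c_i\}_{i\in I}$ and $\{\mathcal{R}_i\}_{i\in I}$ are compatible with $\{\phi_i\}_{i\in I}$.
   Context: A circular ordering of a group $G$ is a function $c:G^3\to\{0,\pm1\}$ such that: $c(a_1,a_2,a_3)=0$ if and only if $a_i=a_j$ for some $i\ne j$; $c(a_2,a_3,a_4)-c(a_1,a_3,a_4)+c(a_1,a_2,a_4)-c(a_1,a_2,a_3)=0$ for all $a_1,\dots,a_4\in G$; and $c(ga_1,ga_2,ga_3)=c(a_1,a_2,a_3)$ for all $g,a_1,a_2,a_3\in G$. $\mathrm{CO}(G)$ is the set of all circular orderings of $G$. For an injective homomorphism $\phi:H\to G$ and $c\in\mathrm{CO}(G)$, the pullback $\phi^*c\in\mathrm{CO}(H)$ is $\phi^*c(h_1,h_2,h_3)=c(\phi(h_1),\phi(h_2),\phi(h_3))$; for $S\subset\mathrm{CO}(G)$, $\phi^*S=\{\phi^*c:c\in S\}$. For $c\in\mathrm{CO}(G)$ and $h\in G$, $c^h\in\mathrm{CO}(G)$ is $c^h(g_1,g_2,g_3)=c(g_1h,g_2h,g_3h)$.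 A normal family is a set $\mathcal{N}\subset\mathrm{CO}(G)$ with $c^h\in\mathcal{N}$ for all $c\in\mathcal{N}$, $h\in G$. For $c\in\mathrm{CO}(G)$, $f_c:G^2\to\mathbb{Z}$ is the (inhomogeneous) 2-cocycle with $f_c(a,b)=0$ if $a=id$ or $b=id$ or $c(id,a,ab)=1$, and $f_c(a,b)=1$ if $ab=id$ with $a\ne id$, or $c(id,ab,a)=1$; $[f_c]\in H^2(G;\mathbb{Z})$ is its class. A set $S\subset\mathrm{CO}(G)$ is cohomologically constant if $[f_c]=[f_{c'}]$ for all $c,c'\in S$. The collection $\{c_i\}_{i\in I}$ is compatible with $\{\phi_i\}_{i\in I}$ if $\phi_i^*c_i=\phi_j^*c_j$ for all $i,j\in I$; sets $S_i\subset\mathrm{CO}(G_i)$ are compatible with $\{\phi_i\}_{i\in I}$ if $\phi_i^*S_i=\phi_j^*S_j$ for all $i,j\in I$. $*_{i\in I}G_i\,(H_i\stackrel{\phi_i}{\cong}H)$ denotes the free product of the $G_i$ amalgamated by identifying $\phi_i(h)$ with $\phi_j(h)$ for all $h\in H$, $i,j\in I$. Each $G_i$ is regarded as a subgroup, and an ordering of the amalgam extends $c_i$ if it restricts to $c_i$ on $G_i$. *)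

theory Defs
  imports "HOL-Algebra.Algebra" "HOL-Library.FuncSet"
begin

section \<open>Circular orderings\<close>

abbreviation triples :: "('a, 'm) monoid_scheme \<Rightarrow> ('a \<times> 'a \<times> 'a) set" where
  "triples G \<equiv> carrier G \<times> carrier G \<times> carrier G"

text \<open>Orderings are extensional functions, so that equality of orderings (and of sets of
  orderings) in HOL is equality of functions on the cube of the carrier.\<close>

definition CO :: "('a, 'm) monoid_scheme \<Rightarrow> ('a \<times> 'a \<times> 'a \<Rightarrow> int) set" where
  "CO G = {c \<in> triples G \<rightarrow>\<^sub>E {-1, 0, 1}.
     (\<forall>a\<^sub>1 \<in> carrier G. \<forall>a\<^sub>2 \<in> carrier G. \<forall>a\<^sub>3 \<in> carrier G.
        c (a\<^sub>1, a\<^sub>2, a\<^sub>3) = 0 \<longleftrightarrow> a\<^sub>1 = a\<^sub>2 \<or> a\<^sub>1 = a\<^sub>3 \<or> a\<^sub>2 = a\<^sub>3) \<and>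
     (\<forall>a\<^sub>1 \<in> carrier G. \<forall>a\<^sub>2 \<in> carrier G. \<forall>a\<^sub>3 \<in> carrier G. \<forall>a\<^sub>4 \<in> carrier G.
        c (a\<^sub>2, a\<^sub>3, a\<^sub>4) - c (a\<^sub>1, a\<^sub>3, a\<^sub>4) + c (a\<^sub>1, a\<^sub>2, a\<^sub>4) - c (a\<^sub>1, a\<^sub>2, a\<^sub>3) = 0) \<and>
     (\<forall>g \<in> carrier G. \<forall>a\<^sub>1 \<in> carrier G. \<forall>a\<^sub>2 \<in> carrier G. \<forall>a\<^sub>3 \<in> carrier G.
        c (g \<otimes>\<^bsub>G\<^esub> a\<^sub>1, g \<otimes>\<^bsub>G\<^esub> a\<^sub>2, g \<otimes>\<^bsub>G\<^esub> a\<^sub>3) = c (a\<^sub>1, a\<^sub>2, a\<^sub>3))}"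

definition pullback ::
  "('h, 'n) monoid_scheme \<Rightarrow> ('h \<Rightarrow> 'a) \<Rightarrow> ('a \<times> 'a \<times> 'a \<Rightarrow> int) \<Rightarrow> ('h \<times> 'h \<times> 'h \<Rightarrow> int)"
  where "pullback H \<phi> c = (\<lambda>(h\<^sub>1, h\<^sub>2, h\<^sub>3) \<in> triples H. c (\<phi> h\<^sub>1, \<phi> h\<^sub>2, \<phi> h\<^sub>3))"

definition conj_ordering ::
  "('a, 'm) monoid_scheme \<Rightarrow> ('a \<times> 'a \<times> 'a \<Rightarrow> int) \<Rightarrow> 'a \<Rightarrow> ('a \<times> 'a \<times> 'a \<Rightarrow> int)"
  where "conj_ordering G c h =
    (\<lambda>(g\<^sub>1, g\<^sub>2, g\<^sub>3) \<in> triples G. c (g\<^sub>1 \<otimes>\<^bsub>G\<^esub> h, g\<^sub>2 \<otimes>\<^bsub>G\<^esub> h, g\<^sub>3 \<otimes>\<^bsub>G\<^esub> h))"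

definition normal_family ::
  "('a, 'm) monoid_scheme \<Rightarrow> ('a \<times> 'a \<times> 'a \<Rightarrow> int) set \<Rightarrow> bool" where
  "normal_family G N \<longleftrightarrow>
     N \<subseteq> CO G \<and> (\<forall>c \<in> N. \<forall>h \<in> carrier G. conj_ordering G c h \<in> N)"

definition compatible_orderings ::
  "'i set \<Rightarrow> ('h, 'n) monoid_scheme \<Rightarrow> ('i \<Rightarrow> 'h \<Rightarrow> 'a) \<Rightarrow> ('i \<Rightarrow> 'a \<times> 'a \<times> 'a \<Rightarrow> int) \<Rightarrow> bool"
  where "compatible_orderings I H \<phi> c \<longleftrightarrow>
    (\<forall>i \<in> I. \<forall>j \<in> I. pullback H (\<phi> i) (c i) = pullback H (\<phi> j) (c j))"

definition compatible_families ::
  "'i set \<Rightarrow> ('h, 'n) monoid_scheme \<Rightarrow> ('i \<Rightarrow> 'h \<Rightarrow> 'a) \<Rightarrow> ('i \<Rightarrow> ('a \<times> 'a \<times> 'a \<Rightarrow> int) set) \<Rightarrow> bool"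
  where "compatible_families I H \<phi> S \<longleftrightarrow>
    (\<forall>i \<in> I. \<forall>j \<in> I. pullback H (\<phi> i) ` S i = pullback H (\<phi> j) ` S j)"

section \<open>Second cohomology with trivial integer coefficients\<close>

text \<open>Inhomogeneous cochains for the trivial action; a class is a coset of the coboundaries in
  the additive group of 2-cocycles.\<close>

definition coboundary1 :: "('a, 'm) monoid_scheme \<Rightarrow> ('a \<Rightarrow> int) \<Rightarrow> ('a \<times> 'a \<Rightarrow> int)" where
  "coboundary1 G d = (\<lambda>(a, b) \<in> carrier G \<times> carrier G. d b - d (a \<otimes>\<^bsub>G\<^esub> b) + d a)"

definition cocycles2 :: "('a, 'm) monoid_scheme \<Rightarrow> ('a \<times> 'a \<Rightarrow> int) monoid" where
  "cocycles2 G = \<lparr>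
     carrier = {f \<in> carrier G \<times> carrier G \<rightarrow>\<^sub>E UNIV.
       \<forall>a \<in> carrier G. \<forall>b \<in> carrier G. \<forall>x \<in> carrier G.
         f (b, x) - f (a \<otimes>\<^bsub>G\<^esub> b, x) + f (a, b \<otimes>\<^bsub>G\<^esub> x) - f (a, b) = 0},
     monoid.mult = (\<lambda>f g. \<lambda>p \<in> carrier G \<times> carrier G. f p + g p),
     monoid.one = (\<lambda>p \<in> carrier G \<times> carrier G. 0)\<rparr>"

definition coboundaries2 :: "('a, 'm) monoid_scheme \<Rightarrow> ('a \<times> 'a \<Rightarrow> int) set" where
  "coboundaries2 G = range (coboundary1 G)"

definition H2 :: "('a, 'm) monoid_scheme \<Rightarrow> ('a \<times> 'a \<Rightarrow> int) set monoid" where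
  "H2 G = cocycles2 G Mod coboundaries2 G"

definition class2 :: "('a, 'm) monoid_scheme \<Rightarrow> ('a \<times> 'a \<Rightarrow> int) \<Rightarrow> ('a \<times> 'a \<Rightarrow> int) set" where
  "class2 G f = coboundaries2 G #>\<^bsub>cocycles2 G\<^esub> f"

text \<open>For a circular ordering \<^term>\<open>c\<close> exactly one of the two cases applies, so the value
  \<^term>\<open>undefined\<close> is never taken on the carrier.\<close>

definition cocycle_of ::
  "('a, 'm) monoid_scheme \<Rightarrow> ('a \<times> 'a \<times> 'a \<Rightarrow> int) \<Rightarrow> ('a \<times> 'a \<Rightarrow> int)" where
  "cocycle_of G c = (\<lambda>(a, b) \<in> carrier G \<times> carrier G.
     if a = \<one>\<^bsub>G\<^esub> \<or> b = \<one>\<^bsub>G\<^esub> \<or> c (\<one>\<^bsub>G\<^esub>, a, a \<otimes>\<^bsub>G\<^esub> b) = 1 then 0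
     else if (a \<otimes>\<^bsub>G\<^esub> b = \<one>\<^bsub>G\<^esub> \<and> a \<noteq> \<one>\<^bsub>G\<^esub>) \<or> c (\<one>\<^bsub>G\<^esub>, a \<otimes>\<^bsub>G\<^esub> b, a) = 1 then 1
     else undefined)"

definition cohomologically_constant ::
  "('a, 'm) monoid_scheme \<Rightarrow> ('a \<times> 'a \<times> 'a \<Rightarrow> int) set \<Rightarrow> bool" where
  "cohomologically_constant G S \<longleftrightarrow>
     S \<subseteq> CO G \<and>
     (\<forall>c \<in> S. \<forall>c' \<in> S. class2 G (cocycle_of G c) = class2 G (cocycle_of G c'))"

section \<open>Free products with amalgamation\<close>

text \<open>Words in the disjoint union of the factors, modulo the congruence generated by the
  multiplication of each factor and by the identification of the images of \<^term>\<open>H\<close>.\<close>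

abbreviation words :: "'i set \<Rightarrow> ('i \<Rightarrow> ('a, 'm) monoid_scheme) \<Rightarrow> ('i \<times> 'a) list set" where
  "words I G \<equiv> lists (SIGMA i:I. carrier (G i))"

inductive_set amalgam_rel ::
  "'i set \<Rightarrow> ('i \<Rightarrow> ('a, 'm) monoid_scheme) \<Rightarrow> ('h, 'n) monoid_scheme \<Rightarrow> ('i \<Rightarrow> 'h \<Rightarrow> 'a) \<Rightarrow>
     (('i \<times> 'a) list \<times> ('i \<times> 'a) list) set"
  for I G H \<phi> where
  refl: "w \<in> words I G \<Longrightarrow> (w, w) \<in> amalgam_rel I G H \<phi>"
| sym: "(u, v) \<in> amalgam_rel I G H \<phi> \<Longrightarrow> (v, u) \<in> amalgam_rel I G H \<phi>"
| trans: "(u, v) \<in> amalgam_rel I G H \<phi> \<Longrightarrow> (v, w) \<in> amalgam_rel I G H \<phi> \<Longrightarrow>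
    (u, w) \<in> amalgam_rel I G H \<phi>"
| append: "(u, u') \<in> amalgam_rel I G H \<phi> \<Longrightarrow> (v, v') \<in> amalgam_rel I G H \<phi> \<Longrightarrow>
    (u @ v, u' @ v') \<in> amalgam_rel I G H \<phi>"
| one: "i \<in> I \<Longrightarrow> ([(i, \<one>\<^bsub>G i\<^esub>)], []) \<in> amalgam_rel I G H \<phi>"
| mult: "i \<in> I \<Longrightarrow> x \<in> carrier (G i) \<Longrightarrow> y \<in> carrier (G i) \<Longrightarrow>
    ([(i, x), (i, y)], [(i, x \<otimes>\<^bsub>G i\<^esub> y)]) \<in> amalgam_rel I G H \<phi>"
| glue: "i \<in> I \<Longrightarrow> j \<in> I \<Longrightarrow> h \<in> carrier H \<Longrightarrow>
    ([(i, \<phi> i h)], [(j, \<phi> j h)]) \<in> amalgam_rel I G H \<phi>"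

definition amalgam ::
  "'i set \<Rightarrow> ('i \<Rightarrow> ('a, 'm) monoid_scheme) \<Rightarrow> ('h, 'n) monoid_scheme \<Rightarrow> ('i \<Rightarrow> 'h \<Rightarrow> 'a) \<Rightarrow>
     ('i \<times> 'a) list set monoid" where
  "amalgam I G H \<phi> = \<lparr>
     carrier = words I G // amalgam_rel I G H \<phi>,
     monoid.mult = (\<lambda>A B. \<Union>u \<in> A. \<Union>v \<in> B. amalgam_rel I G H \<phi> `` {u @ v}),
     monoid.one = amalgam_rel I G H \<phi> `` {[]}\<rparr>"

definition amalgam_incl ::
  "'i set \<Rightarrow> ('i \<Rightarrow> ('a, 'm) monoid_scheme) \<Rightarrow> ('h, 'n) monoid_scheme \<Rightarrow> ('i \<Rightarrow> 'h \<Rightarrow> 'a) \<Rightarrow>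
     'i \<Rightarrow> 'a \<Rightarrow> ('i \<times> 'a) list set" where
  "amalgam_incl I G H \<phi> i g = amalgam_rel I G H \<phi> `` {[(i, g)]}"

text \<open>Each factor is regarded as a subgroup of the amalgam through \<^const>\<open>amalgam_incl\<close>, so
  restriction to a factor is pullback along it.\<close>

definition extends_orderings ::
  "'i set \<Rightarrow> ('i \<Rightarrow> ('a, 'm) monoid_scheme) \<Rightarrow> ('h, 'n) monoid_scheme \<Rightarrow> ('i \<Rightarrow> 'h \<Rightarrow> 'a) \<Rightarrow>
     (('i \<times> 'a) list set \<times> ('i \<times> 'a) list set \<times> ('i \<times> 'a) list set \<Rightarrow> int) \<Rightarrow>
     ('i \<Rightarrow> 'a \<times> 'a \<times> 'a \<Rightarrow> int) \<Rightarrow> bool" where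
  "extends_orderings I G H \<phi> c cs \<longleftrightarrow>
     (\<forall>i \<in> I. pullback (G i) (amalgam_incl I G H \<phi> i) c = cs i)"

section \<open>Basic facts\<close>

text \<open>The amalgam is a group, the maps of the factors into it are homomorphisms that agree on
  \<^term>\<open>H\<close>, and every compatible family of homomorphisms factors through it (uniqueness being
  clear, as it is generated by the factors). The function \<^const>\<open>cocycle_of\<close> takes values in
  2-cocycles, so that it has a class in \<^const>\<open>H2\<close>.\<close>

locale amalgam_data =
  fixes I :: "'i set" and G :: "'i \<Rightarrow> ('a, 'm) monoid_scheme"
    and H :: "('h, 'n) monoid_scheme" and \<phi> :: "'i \<Rightarrow> 'h \<Rightarrow> 'a"
  assumes gG: "\<And>i. i \<in> I \<Longrightarrow> group (G i)" and hp: "\<And>i. i \<in> I \<Longrightarrow> \<phi> i \<in> hom H (G i)"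
begin

lemma amalgam_rel_words:
  assumes "(u, v) \<in> amalgam_rel I G H \<phi>"
  shows "u \<in> words I G \<and> v \<in> words I G"
  using assms
  by induction (auto intro: group.is_monoid monoid.one_closed monoid.m_closed gG hom_in_carrier[OF hp])

lemma equiv_amalgam_rel:
  shows "equiv (words I G) (amalgam_rel I G H \<phi>)"
  using amalgam_rel_words
  by (intro equivI refl_onI symI transI subrelI)
     (blast intro: amalgam_rel.intros)+

lemma amalgam_mult_class:
  assumes "u \<in> words I G" "v \<in> words I G"
  shows "amalgam_rel I G H \<phi> `` {u} \<otimes>\<^bsub>amalgam I G H \<phi>\<^esub> amalgam_rel I G H \<phi> `` {v} =
    amalgam_rel I G H \<phi> `` {u @ v}"
proof -
  let ?R = "amalgam_rel I G H \<phi>"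
  have eq: "equiv (words I G) ?R" using equiv_amalgam_rel .
  have "?R `` {u' @ v'} = ?R `` {u @ v}" if "u' \<in> ?R `` {u}" "v' \<in> ?R `` {v}" for u' v'
    using that by (intro equiv_class_eq[OF eq]) (auto intro: amalgam_rel.sym amalgam_rel.append)
  moreover have "u \<in> ?R `` {u}" "v \<in> ?R `` {v}"
    using assms by (auto intro: amalgam_rel.refl)
  ultimately have "(\<Union>x \<in> ?R `` {u}. \<Union>y \<in> ?R `` {v}. ?R `` {x @ y}) = ?R `` {u @ v}" by blast
  then show ?thesis by (simp add: amalgam_def)
qed

lemma amalgam_cancel:
  assumes "w \<in> words I G"
  shows "\<exists>w' \<in> words I G. (w' @ w, []) \<in> amalgam_rel I G H \<phi>"
  using assms
proof (induction w)
  case Nil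
  show ?case by (intro bexI[of _ "[]"]) (auto intro: amalgam_rel.refl)
next
  case (Cons p w)
  obtain i x where p: "p = (i, x)" "i \<in> I" "x \<in> carrier (G i)" using Cons by auto
  obtain w' where w': "w' \<in> words I G" "(w' @ w, []) \<in> amalgam_rel I G H \<phi>" using Cons by auto
  have w: "w \<in> words I G" using Cons by auto
  have G: "group (G i)" using gG p by auto
  let ?y = "inv\<^bsub>G i\<^esub> x"
  have y: "?y \<in> carrier (G i)" using G p by simp
  have "([(i, ?y), (i, x)], [(i, ?y \<otimes>\<^bsub>G i\<^esub> x)]) \<in> amalgam_rel I G H \<phi>"
    using p y by (intro amalgam_rel.mult)
  hence "([(i, ?y), (i, x)], []) \<in> amalgam_rel I G H \<phi>"
    using amalgam_rel.one[OF p(2)] G p by (auto simp: group.l_inv intro: amalgam_rel.trans)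
  from amalgam_rel.append[OF amalgam_rel.append[OF amalgam_rel.refl[OF w'(1)] this] amalgam_rel.refl[OF w]]
  have "((w' @ [(i, ?y)]) @ p # w, w' @ w) \<in> amalgam_rel I G H \<phi>" using p by simp
  from amalgam_rel.trans[OF this w'(2)] show ?case
    using w' p y by (intro bexI[of _ "w' @ [(i, ?y)]"]) auto
qed

lemma group_amalgam:
  shows "group (amalgam I G H \<phi>)"
proof -
  let ?R = "amalgam_rel I G H \<phi>"
  note eq = equiv_amalgam_rel
  note m = amalgam_mult_class
  have carr: "carrier (amalgam I G H \<phi>) = (\<lambda>w. ?R `` {w}) ` words I G"
    by (auto simp: amalgam_def quotient_def)
  have one: "\<one>\<^bsub>amalgam I G H \<phi>\<^esub> = ?R `` {[]}" by (simp add: amalgam_def)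
  show ?thesis
  proof (rule groupI)
    fix A assume "A \<in> carrier (amalgam I G H \<phi>)"
    then obtain w where w: "w \<in> words I G" "A = ?R `` {w}" by (auto simp: carr)
    obtain w' where w': "w' \<in> words I G" "(w' @ w, []) \<in> ?R" using amalgam_cancel[OF w(1)] by auto
    show "\<exists>B \<in> carrier (amalgam I G H \<phi>). B \<otimes>\<^bsub>amalgam I G H \<phi>\<^esub> A = \<one>\<^bsub>amalgam I G H \<phi>\<^esub>"
      using w w' m[OF w'(1) w(1)] equiv_class_eq[OF eq w'(2)]
      by (intro bexI[of _ "?R `` {w'}"]) (auto simp: one carr)
  next
    show "\<one>\<^bsub>amalgam I G H \<phi>\<^esub> \<in> carrier (amalgam I G H \<phi>)" by (auto simp: carr one)
  next
    fix A B C assume "A \<in> carrier (amalgam I G H \<phi>)" "B \<in> carrier (amalgam I G H \<phi>)"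
      "C \<in> carrier (amalgam I G H \<phi>)"
    then obtain u v w where uvw: "u \<in> words I G" "v \<in> words I G" "w \<in> words I G"
      "A = ?R `` {u}" "B = ?R `` {v}" "C = ?R `` {w}" unfolding carr by (elim imageE)
    then have uv: "u @ v \<in> words I G" "v @ w \<in> words I G" by (simp_all only: append_in_lists_conv)
    show "A \<otimes>\<^bsub>amalgam I G H \<phi>\<^esub> B \<otimes>\<^bsub>amalgam I G H \<phi>\<^esub> C =
      A \<otimes>\<^bsub>amalgam I G H \<phi>\<^esub> (B \<otimes>\<^bsub>amalgam I G H \<phi>\<^esub> C)"
      unfolding uvw m[OF uvw(1,2)] m[OF uvw(2,3)] m[OF uv(1) uvw(3)] m[OF uvw(1) uv(2)] by simp
    show "A \<otimes>\<^bsub>amalgam I G H \<phi>\<^esub> B \<in> carrier (amalgam I G H \<phi>)"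
      unfolding uvw m[OF uvw(1,2)] carr using uv(1) by (rule imageI)
    show "\<one>\<^bsub>amalgam I G H \<phi>\<^esub> \<otimes>\<^bsub>amalgam I G H \<phi>\<^esub> A = A"
      unfolding uvw one m[OF lists.Nil uvw(1)] by simp
  qed
qed

lemma amalgam_incl_hom:
  assumes "i \<in> I"
  shows "amalgam_incl I G H \<phi> i \<in> hom (G i) (amalgam I G H \<phi>)"
proof (rule homI)
  fix x y assume xy: "x \<in> carrier (G i)" "y \<in> carrier (G i)"
  show "amalgam_incl I G H \<phi> i x \<in> carrier (amalgam I G H \<phi>)"
    using xy assms by (auto simp: amalgam_incl_def amalgam_def intro!: quotientI)
  show "amalgam_incl I G H \<phi> i (x \<otimes>\<^bsub>G i\<^esub> y) =
      amalgam_incl I G H \<phi> i x \<otimes>\<^bsub>amalgam I G H \<phi>\<^esub> amalgam_incl I G H \<phi> i y"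
  proof -
    have w: "[(i, x)] \<in> words I G" "[(i, y)] \<in> words I G" using xy assms by simp_all
    show ?thesis
      unfolding amalgam_incl_def amalgam_mult_class[OF w]
      using amalgam_rel.sym[OF amalgam_rel.mult[where ?G = G and H = H and \<phi> = \<phi>, OF assms xy]]
      by (simp add: equiv_class_eq[OF equiv_amalgam_rel])
  qed
qed

lemma amalgam_incl_glue:
  assumes "i \<in> I" "j \<in> I" "h \<in> carrier H"
  shows "amalgam_incl I G H \<phi> i (\<phi> i h) = amalgam_incl I G H \<phi> j (\<phi> j h)"
  unfolding amalgam_incl_def
  by (intro equiv_class_eq[OF equiv_amalgam_rel] amalgam_rel.glue assms)

lemma amalgam_universal:
  assumes "group K" "\<And>i. i \<in> I \<Longrightarrow> \<psi> i \<in> hom (G i) K"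
    and "\<And>i j h. i \<in> I \<Longrightarrow> j \<in> I \<Longrightarrow> h \<in> carrier H \<Longrightarrow> \<psi> i (\<phi> i h) = \<psi> j (\<phi> j h)"
  shows "\<exists>\<theta> \<in> hom (amalgam I G H \<phi>) K. \<forall>i\<in>I. \<forall>x \<in> carrier (G i). \<theta> (amalgam_incl I G H \<phi> i x) = \<psi> i x"
proof -
  interpret K: group K by fact
  let ?R = "amalgam_rel I G H \<phi>"
  define ev where "ev w = foldr (\<lambda>(i,x) k. \<psi> i x \<otimes>\<^bsub>K\<^esub> k) w \<one>\<^bsub>K\<^esub>" for w
  have cl: "ev w \<in> carrier K" if "w \<in> words I G" for w
    using that by (induction w) (auto simp: ev_def hom_in_carrier[OF assms(2)])
  have app: "ev (u @ v) = ev u \<otimes>\<^bsub>K\<^esub> ev v" if "u \<in> words I G" "v \<in> words I G" for u v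
    using that(1)
  proof (induction u)
    case Nil show ?case using cl[OF that(2)] by (simp add: ev_def)
  next
    case (Cons p u)
    thus ?case using cl[OF that(2)] cl[of u] by (cases p) (auto simp: ev_def K.m_assoc hom_in_carrier[OF assms(2)])
  qed
  have inv: "ev u = ev v" if "(u,v) \<in> ?R" for u v
    using that
  proof induction
    case (append u u' v v')
    thus ?case using amalgam_rel_words by (metis app)
  next
    case (one i)
    thus ?case using hom_one[OF assms(2) gG assms(1)] by (simp add: ev_def)
  next
    case (mult i x y)
    thus ?case using assms(2)[OF mult(1)] by (auto simp: ev_def hom_def Pi_iff K.m_assoc)
  next
    case (glue i j h)
    thus ?case using assms(3)[OF glue] by (simp add: ev_def)
  qed auto
  define \<theta> where "\<theta> A = ev (SOME w. w \<in> A)" for A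
  have th: "\<theta> (?R `` {w}) = ev w" if "w \<in> words I G" for w
  proof -
    have "w \<in> ?R `` {w}" using that by (auto intro: amalgam_rel.refl)
    then have "(SOME w'. w' \<in> ?R `` {w}) \<in> ?R `` {w}" by (rule someI)
    then have "(w, SOME w'. w' \<in> ?R `` {w}) \<in> ?R" by blast
    from inv[OF this] show ?thesis unfolding \<theta>_def by (rule HOL.sym)
  qed
  show ?thesis
  proof (intro bexI[of _ \<theta>] homI ballI)
    fix A B assume "A \<in> carrier (amalgam I G H \<phi>)" "B \<in> carrier (amalgam I G H \<phi>)"
    then obtain u v where "u \<in> words I G" "v \<in> words I G" "A = ?R `` {u}" "B = ?R `` {v}"
      by (auto simp: amalgam_def quotient_def)
    thus "\<theta> (A \<otimes>\<^bsub>amalgam I G H \<phi>\<^esub> B) = \<theta> A \<otimes>\<^bsub>K\<^esub> \<theta> B"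
      by (simp add: amalgam_mult_class th app)
  next
    fix A assume "A \<in> carrier (amalgam I G H \<phi>)"
    then obtain w where "w \<in> words I G" "A = ?R `` {w}"
      by (auto simp: amalgam_def quotient_def)
    thus "\<theta> A \<in> carrier K" by (simp only: th cl)
  next
    fix i x assume "i \<in> I" "x \<in> carrier (G i)"
    thus "\<theta> (amalgam_incl I G H \<phi> i x) = \<psi> i x"
      by (simp add: amalgam_incl_def th ev_def hom_in_carrier[OF assms(2)])
  qed
qed

end

lemma cocycle_of_cocycle:
  fixes G (structure)
  assumes "group G" "c \<in> CO G"
  shows "cocycle_of G c \<in> carrier (cocycles2 G)"
proof -
  interpret group G by fact
  have z: "c (a,b,d) = 0 \<longleftrightarrow> a = b \<or> a = d \<or> b = d" if "a \<in> carrier G" "b \<in> carrier G" "d \<in> carrier G" for a b d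
    using assms(2) that by (auto simp: CO_def)
  have v: "c (a,b,d) \<in> {-1,0,1}" if "a \<in> carrier G" "b \<in> carrier G" "d \<in> carrier G" for a b d
    using assms(2) that PiE_mem[of c "triples G" "\<lambda>_. {-1,0,1}" "(a,b,d)"] by (simp add: CO_def)
  have co: "c (b,d,e) - c (a,d,e) + c (a,b,e) - c (a,b,d) = 0" if "a \<in> carrier G" "b \<in> carrier G" "d \<in> carrier G" "e \<in> carrier G" for a b d e
    using assms(2) that by (auto simp: CO_def)
  have inv: "c (g \<otimes> a, g \<otimes> b, g \<otimes> d) = c (a,b,d)" if "g \<in> carrier G" "a \<in> carrier G" "b \<in> carrier G" "d \<in> carrier G" for g a b d
    using assms(2) that by (auto simp: CO_def)
  have sw: "c (a,d,b) = - c (a,b,d)" if "a \<in> carrier G" "b \<in> carrier G" "d \<in> carrier G" for a b d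
  proof -
    have "c (b,d,b) = 0" "c (a,b,b) = 0" using z that by blast+
    with co[OF that(1,2,3,2)] show ?thesis by linarith
  qed
  define e where "e x = (if x = \<one> then (1::int) else 0)" for x
  have twice: "2 * cocycle_of G c (a,b) = 1 - c (\<one>,a,a\<otimes>b) - e a - e b + e (a \<otimes> b)"
    if ab: "a \<in> carrier G" "b \<in> carrier G" for a b
  proof -
    have ab': "a \<otimes> b \<in> carrier G" "a = a \<otimes> b \<longleftrightarrow> b = \<one>" using ab by (auto simp: r_cancel_one')
    define p where "p = c (\<one>,a,a\<otimes>b)"
    have p: "c (\<one>,a\<otimes>b,a) = - p" unfolding p_def by (rule sw) (use ab ab' in auto)
    have "p \<in> {-1,0,1}" unfolding p_def by (rule v) (use ab ab' in auto)
    moreover have "p = 0 \<longleftrightarrow> a = \<one> \<or> a \<otimes> b = \<one> \<or> b = \<one>"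
      unfolding p_def using z[OF one_closed ab(1) ab'(1)] ab' by metis
    moreover have "cocycle_of G c (a,b) = (if a = \<one> \<or> b = \<one> \<or> p = 1 then 0
        else if (a \<otimes> b = \<one> \<and> a \<noteq> \<one>) \<or> - p = 1 then 1 else undefined)"
      using ab by (simp add: cocycle_of_def p p_def[symmetric])
    moreover have "a = \<one> \<Longrightarrow> a \<otimes> b = b" "b = \<one> \<Longrightarrow> a \<otimes> b = a" using ab by auto
    ultimately show ?thesis unfolding p_def[symmetric] e_def by (cases "a = \<one>"; cases "b = \<one>"; cases "a \<otimes> b = \<one>") auto
  qed
  have "cocycle_of G c (b, x) - cocycle_of G c (a \<otimes> b, x) + cocycle_of G c (a, b \<otimes> x) - cocycle_of G c (a, b) = 0"
    if abx: "a \<in> carrier G" "b \<in> carrier G" "x \<in> carrier G" for a b x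
  proof -
    have "c (\<one>, b, b \<otimes> x) = c (a, a \<otimes> b, a \<otimes> b \<otimes> x)"
      using inv[of a \<one> b "b \<otimes> x"] abx by (simp add: m_assoc)
    moreover have "c (a, a \<otimes> b, a \<otimes> b \<otimes> x) - c (\<one>, a \<otimes> b, a \<otimes> b \<otimes> x) + c (\<one>, a, a \<otimes> b \<otimes> x) - c (\<one>, a, a \<otimes> b) = 0"
      by (rule co) (use abx in auto)
    moreover have "a \<otimes> (b \<otimes> x) = a \<otimes> b \<otimes> x" using abx by (simp add: m_assoc)
    moreover have "b \<otimes> x \<in> carrier G" "a \<otimes> b \<in> carrier G" using abx by auto
    ultimately show ?thesis using twice[of b x] twice[of "a \<otimes> b" x] twice[of a "b \<otimes> x"] twice[of a b] abx
      by simp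
  qed
  then show ?thesis by (auto simp: cocycles2_def cocycle_of_def)
qed

lemma H2_group:
  assumes "group G" shows "comm_group (cocycles2 G)" "subgroup (coboundaries2 G) (cocycles2 G)"
proof -
  interpret group G by fact
  show *: "comm_group (cocycles2 G)"
  proof (rule comm_groupI)
    fix f assume f: "f \<in> carrier (cocycles2 G)"
    show "\<exists>g \<in> carrier (cocycles2 G). g \<otimes>\<^bsub>cocycles2 G\<^esub> f = \<one>\<^bsub>cocycles2 G\<^esub>"
      using f by (intro bexI[of _ "\<lambda>p\<in>carrier G \<times> carrier G. - f p"]) (auto simp: cocycles2_def, smt (verit))
  qed (auto simp: cocycles2_def algebra_simps intro!: ext split: if_splits simp: restrict_def PiE_iff extensional_def)
  interpret Z: comm_group "cocycles2 G" by fact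
  have B: "coboundaries2 G \<subseteq> carrier (cocycles2 G)"
    by (auto simp: coboundaries2_def coboundary1_def cocycles2_def m_assoc)
  show "subgroup (coboundaries2 G) (cocycles2 G)"
  proof (rule Z.subgroupI[OF B])
    show "coboundaries2 G \<noteq> {}" by (auto simp: coboundaries2_def)
  next
    fix f assume f: "f \<in> coboundaries2 G"
    then obtain d where d: "f = coboundary1 G d" by (auto simp: coboundaries2_def)
    have "inv\<^bsub>cocycles2 G\<^esub> f = coboundary1 G (\<lambda>x. - d x)"
      using f d B by (intro Z.inv_equality) (auto simp: coboundaries2_def, auto simp: cocycles2_def coboundary1_def intro!: ext)
    thus "inv\<^bsub>cocycles2 G\<^esub> f \<in> coboundaries2 G" by (auto simp: coboundaries2_def)
  next
    fix f g assume "f \<in> coboundaries2 G" "g \<in> coboundaries2 G"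
    then obtain d d' where d: "f = coboundary1 G d" "g = coboundary1 G d'" by (auto simp: coboundaries2_def)
    have "f \<otimes>\<^bsub>cocycles2 G\<^esub> g = coboundary1 G (\<lambda>x. d x + d' x)"
      by (auto simp: d cocycles2_def coboundary1_def intro!: ext)
    thus "f \<otimes>\<^bsub>cocycles2 G\<^esub> g \<in> coboundaries2 G" by (auto simp: coboundaries2_def)
  qed
qed

lemma class2_cocycle_of_in_H2:
  assumes "group G" "c \<in> CO G"
  shows "class2 G (cocycle_of G c) \<in> carrier (H2 G)"
  using cocycle_of_cocycle[OF assms]
  by (auto simp: H2_def FactGroup_def RCOSETS_def class2_def)

end

theory Submission
  imports Defs
begin

text \<open>Write \<open>A\<close> for the amalgam, \<open>\<iota>\<^sub>i\<close> for the map \<open>G\<^sub>i \<rightarrow> A\<close>, and \<open>c\<close> for the circular ordering on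
  \<open>A\<close>. The translates \<open>c\<^sup>x\<close>, for \<open>x\<close> in \<open>A\<close>, form a normal family on \<open>A\<close>, and \<open>R\<^sub>i\<close> is the set of
  their restrictions \<open>\<iota>\<^sub>i\<^sup>*(c\<^sup>x)\<close> to \<open>G\<^sub>i\<close>. Moving \<open>\<iota>\<^sub>i\<^sup>*(c\<^sup>x)\<close> by \<open>h\<close> in \<open>G\<^sub>i\<close> yields
  \<open>\<iota>\<^sub>i\<^sup>*(c\<^sup>y)\<close> with \<open>y = \<iota>\<^sub>i(h) x\<close>, so \<open>R\<^sub>i\<close> is normal. Since
  all the composites \<open>\<iota>\<^sub>i \<circ> \<phi>\<^sub>i\<close> agree on \<open>H\<close>, the restrictions to \<open>H\<close> of \<open>c\<^sup>x\<close> through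
  different factors are equal, which gives both compatibility claims.

  The substance is cohomological constancy: right translation by \<open>x\<close> must not change the class.
  Twice the cocycle \<open>f\<^sub>c\<close> is, up to a term that does not depend on \<open>c\<close>, the inhomogeneous form
  of \<open>- c\<close>. Right multiplication by \<open>x\<close> is an equivariant self-map of \<open>A\<close> as a left \<open>A\<close>-set, and the
  prism operator between it and the identity shows that \<open>c - c\<^sup>x\<close> is the coboundary of
  \<open>\<delta>(a) = c(1, a, ax) - c(1, x, ax)\<close> (lemma \<open>coboundary_prism\<close>). This settles the matter only after
  multiplication by 2, and \<open>H\<^sup>2\<close> may have 2-torsion; but the two terms of \<open>\<delta>(a)\<close> vanish for the
  same \<open>a\<close> and are odd otherwise, so \<open>\<delta>\<close> takes even values (lemma \<open>even_prism\<close>) and its half is an integral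
  cochain.

  That each \<open>\<iota>\<^sub>i\<^sup>*(c\<^sup>x)\<close> is again a circular ordering follows from the hypothesis on \<open>c\<close>:
  \<open>\<iota>\<^sub>i\<^sup>*(c\<^sup>x)\<close> and \<open>\<iota>\<^sub>i\<^sup>*c\<close> vanish on the same triples, namely those on which two values
  of \<open>\<iota>\<^sub>i\<close> coincide, and for \<open>\<iota>\<^sub>i\<^sup>*c = c\<^sub>i\<close> these are known to be the degenerate ones.\<close>

section \<open>Circular orderings and their cocycles\<close>

lemma CO_range:
  assumes "c \<in> CO G" "a \<in> carrier G" "b \<in> carrier G" "d \<in> carrier G"
  shows "c (a, b, d) \<in> {-1, 0, 1}"
  using assms PiE_mem[of c "triples G" "\<lambda>_. {-1, 0, 1}" "(a, b, d)"] by (simp add: CO_def)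

lemma CO_zero_iff:
  assumes "c \<in> CO G" "a \<in> carrier G" "b \<in> carrier G" "d \<in> carrier G"
  shows "c (a, b, d) = 0 \<longleftrightarrow> a = b \<or> a = d \<or> b = d"
  using assms by (simp add: CO_def)

lemma CO_cocycle:
  assumes "c \<in> CO G" "a \<in> carrier G" "b \<in> carrier G" "d \<in> carrier G" "e \<in> carrier G"
  shows "c (b, d, e) - c (a, d, e) + c (a, b, e) - c (a, b, d) = 0"
  using assms by (simp add: CO_def)

lemma CO_left_invariant:
  assumes "c \<in> CO G" "g \<in> carrier G" "a \<in> carrier G" "b \<in> carrier G" "d \<in> carrier G"
  shows "c (g \<otimes>\<^bsub>G\<^esub> a, g \<otimes>\<^bsub>G\<^esub> b, g \<otimes>\<^bsub>G\<^esub> d) = c (a, b, d)"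
  using assms by (simp add: CO_def)

lemma CO_swap:
  assumes "c \<in> CO G" "a \<in> carrier G" "b \<in> carrier G" "d \<in> carrier G"
  shows "c (a, d, b) = - c (a, b, d)"
  using CO_cocycle[OF assms(1,2,3,4,3)] CO_zero_iff[OF assms(1,3,4,3)] CO_zero_iff[OF assms(1,2,3,3)]
  by simp

text \<open>Two circular orderings give cocycles whose doubles differ by the difference of the
  homogeneous cocycles: the correction terms only see which elements are trivial.\<close>

lemma twice_cocycle_of:
  fixes G (structure)
  assumes "group G" "c \<in> CO G" and ab: "a \<in> carrier G" "b \<in> carrier G"
  shows "2 * cocycle_of G c (a, b) =
    1 - c (\<one>, a, a \<otimes> b) - of_bool (a = \<one>) - of_bool (b = \<one>) + of_bool (a \<otimes> b = \<one>)"
proof -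
  interpret group G by fact
  have ab': "a \<otimes> b \<in> carrier G" "a = a \<otimes> b \<longleftrightarrow> b = \<one>"
    using ab by (auto simp: r_cancel_one')
  define p where "p = c (\<one>, a, a \<otimes> b)"
  have "c (\<one>, a \<otimes> b, a) = - p"
    unfolding p_def by (rule CO_swap[OF assms(2)]) (use ab ab' in auto)
  then have "cocycle_of G c (a, b) = (if a = \<one> \<or> b = \<one> \<or> p = 1 then 0
      else if (a \<otimes> b = \<one> \<and> a \<noteq> \<one>) \<or> - p = 1 then 1 else undefined)"
    using ab by (simp add: cocycle_of_def p_def[symmetric])
  moreover have "p \<in> {-1, 0, 1}"
    unfolding p_def by (rule CO_range[OF assms(2)]) (use ab ab' in auto)
  moreover have "p = 0 \<longleftrightarrow> a = \<one> \<or> a \<otimes> b = \<one> \<or> b = \<one>"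
    unfolding p_def using CO_zero_iff[OF assms(2) one_closed ab(1) ab'(1)] ab' by metis
  moreover have "a = \<one> \<Longrightarrow> a \<otimes> b = b" "b = \<one> \<Longrightarrow> a \<otimes> b = a" using ab by auto
  ultimately show ?thesis
    unfolding p_def[symmetric] by (cases "a = \<one>"; cases "b = \<one>"; cases "a \<otimes> b = \<one>") auto
qed

lemma class2_eqI:
  assumes "group G" "f \<in> carrier (cocycles2 G)" "f' \<in> carrier (cocycles2 G)"
    and "\<And>a b. a \<in> carrier G \<Longrightarrow> b \<in> carrier G \<Longrightarrow>
      f' (a, b) = f (a, b) + (d b - d (a \<otimes>\<^bsub>G\<^esub> b) + d a)"
  shows "class2 G f = class2 G f'"
proof -
  interpret Z: comm_group "cocycles2 G" by (rule H2_group(1)[OF assms(1)])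
  have "f' = coboundary1 G d \<otimes>\<^bsub>cocycles2 G\<^esub> f"
  proof (rule extensionalityI[of _ "carrier G \<times> carrier G"])
    show "f' \<in> extensional (carrier G \<times> carrier G)"
      using assms(3) by (auto simp: cocycles2_def PiE_def)
  qed (auto simp: cocycles2_def coboundary1_def assms(4))
  then have "f' \<in> coboundaries2 G #>\<^bsub>cocycles2 G\<^esub> f"
    by (auto simp: r_coset_def coboundaries2_def)
  then show ?thesis
    unfolding class2_def using assms(2) H2_group(2)[OF assms(1)]
    by (rule Z.repr_independence)
qed

section \<open>Right translation does not change the class\<close>

text \<open>The cochain obtained from a circular ordering by triangulating the prism with edges \<open>[1, a]\<close>
  and \<open>[x, ax]\<close>.\<close>

definition prism :: "('a, 'm) monoid_scheme \<Rightarrow> ('a \<times> 'a \<times> 'a \<Rightarrow> int) \<Rightarrow> 'a \<Rightarrow> 'a \<Rightarrow> int" where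
  "prism G c x a = c (\<one>\<^bsub>G\<^esub>, a, a \<otimes>\<^bsub>G\<^esub> x) - c (\<one>\<^bsub>G\<^esub>, x, a \<otimes>\<^bsub>G\<^esub> x)"

text \<open>The prism over the triangle \<open>1, a, ab\<close> is cut into three tetrahedra, on each of which \<open>c\<close> is
  closed; the faces in the interior of the prism cancel.\<close>

lemma coboundary_prism:
  fixes G (structure)
  assumes "group G" "c \<in> CO G" and abx: "a \<in> carrier G" "b \<in> carrier G" "x \<in> carrier G"
  shows "prism G c x b - prism G c x (a \<otimes> b) + prism G c x a =
    c (\<one>, a, a \<otimes> b) - c (x, a \<otimes> x, a \<otimes> b \<otimes> x)"
proof -
  interpret group G by fact
  have cl: "a \<otimes> b \<in> carrier G" "a \<otimes> x \<in> carrier G" "a \<otimes> b \<otimes> x \<in> carrier G" "b \<otimes> x \<in> carrier G"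
    using abx by auto
  have "c (a, a \<otimes> b, a \<otimes> b \<otimes> x) = c (\<one>, b, b \<otimes> x)"
    using CO_left_invariant[OF assms(2) abx(1) one_closed abx(2) cl(4)] abx by (simp add: m_assoc)
  moreover have "c (a, a \<otimes> x, a \<otimes> b \<otimes> x) = c (\<one>, x, b \<otimes> x)"
    using CO_left_invariant[OF assms(2) abx(1) one_closed abx(3) cl(4)] abx by (simp add: m_assoc)
  moreover note CO_cocycle[OF assms(2) one_closed abx(1) cl(1) cl(3)]
    CO_cocycle[OF assms(2) one_closed abx(1) cl(2) cl(3)]
    CO_cocycle[OF assms(2) one_closed abx(3) cl(2) cl(3)]
  ultimately show ?thesis unfolding prism_def by linarith
qed

text \<open>If \<open>x \<noteq> 1\<close>, both triangles in the definition of the prism are degenerate precisely when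
  \<open>a = 1\<close> or \<open>ax = 1\<close>; a non-degenerate triangle has an odd value. If \<open>x = 1\<close>, both are degenerate.\<close>

lemma even_prism:
  fixes G (structure)
  assumes "group G" "c \<in> CO G" and ax: "a \<in> carrier G" "x \<in> carrier G"
  shows "even (prism G c x a)"
proof -
  interpret group G by fact
  have cl: "a \<otimes> x \<in> carrier G" using ax by simp
  have eqs: "a = a \<otimes> x \<longleftrightarrow> x = \<one>" "x = a \<otimes> x \<longleftrightarrow> a = \<one>"
    using ax by (auto simp: r_cancel_one' l_cancel_one')
  have "c (\<one>, a, a \<otimes> x) = 0 \<longleftrightarrow> c (\<one>, x, a \<otimes> x) = 0"
    unfolding CO_zero_iff[OF assms(2) one_closed ax(1) cl] CO_zero_iff[OF assms(2) one_closed ax(2) cl]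
      eqs using ax by auto
  then show ?thesis
    using CO_range[OF assms(2) one_closed ax(1) cl] CO_range[OF assms(2) one_closed ax(2) cl]
    unfolding prism_def by auto
qed

section \<open>Restricting translates along a homomorphism\<close>

lemma pullback_conj_ordering_apply:
  assumes "f \<in> hom K G" "k\<^sub>1 \<in> carrier K" "k\<^sub>2 \<in> carrier K" "k\<^sub>3 \<in> carrier K"
  shows "pullback K f (conj_ordering G c x) (k\<^sub>1, k\<^sub>2, k\<^sub>3) =
    c (f k\<^sub>1 \<otimes>\<^bsub>G\<^esub> x, f k\<^sub>2 \<otimes>\<^bsub>G\<^esub> x, f k\<^sub>3 \<otimes>\<^bsub>G\<^esub> x)"
  using assms by (simp add: pullback_def conj_ordering_def hom_in_carrier)

text \<open>The axiom at stake is non-degeneracy. A triple on which two values of \<open>f\<close> coincide is one where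
  the pullback of \<open>c\<close> itself vanishes, hence is degenerate.\<close>

lemma pullback_conj_ordering_in_CO:
  assumes "group K" "group G" and f: "f \<in> hom K G" and c: "c \<in> CO G"
    and fc: "pullback K f c \<in> CO K" and x: "x \<in> carrier G"
  shows "pullback K f (conj_ordering G c x) \<in> CO K"
proof -
  interpret K: group K by fact
  interpret G: group G by fact
  let ?p = "pullback K f (conj_ordering G c x)"
  have fx: "f k \<otimes>\<^bsub>G\<^esub> x \<in> carrier G" if "k \<in> carrier K" for k
    using that x hom_in_carrier[OF f] by simp
  note app = pullback_conj_ordering_apply[OF f, of _ _ _ c x]
  have ext: "?p \<in> triples K \<rightarrow>\<^sub>E {-1, 0, 1}"
  proof (rule PiE_I)
    fix t assume "t \<in> triples K"
    then obtain k\<^sub>1 k\<^sub>2 k\<^sub>3 where k: "t = (k\<^sub>1, k\<^sub>2, k\<^sub>3)" "k\<^sub>1 \<in> carrier K" "k\<^sub>2 \<in> carrier K" "k\<^sub>3 \<in> carrier K"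
      by auto
    show "?p t \<in> {-1, 0, 1}"
      unfolding k(1) app[OF k(2-4)] by (rule CO_range[OF c fx fx fx]) (use k in auto)
  next
    fix t assume "t \<notin> triples K"
    then show "?p t = undefined" by (simp only: pullback_def restrict_apply if_False)
  qed
  have zero: "?p (a, b, d) = 0 \<longleftrightarrow> a = b \<or> a = d \<or> b = d"
    if k: "a \<in> carrier K" "b \<in> carrier K" "d \<in> carrier K" for a b d
  proof -
    note fk = k[THEN hom_in_carrier[OF f]]
    have "?p (a, b, d) = 0 \<longleftrightarrow> f a = f b \<or> f a = f d \<or> f b = f d"
      unfolding app[OF k] CO_zero_iff[OF c fx[OF k(1)] fx[OF k(2)] fx[OF k(3)]]
      using fk x by simp
    also have "\<dots> \<longleftrightarrow> pullback K f c (a, b, d) = 0"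
      using k CO_zero_iff[OF c fk] by (simp add: pullback_def)
    also have "\<dots> \<longleftrightarrow> a = b \<or> a = d \<or> b = d" by (rule CO_zero_iff[OF fc k])
    finally show ?thesis .
  qed
  have cocycle: "?p (b, d, e) - ?p (a, d, e) + ?p (a, b, e) - ?p (a, b, d) = 0"
    if "a \<in> carrier K" "b \<in> carrier K" "d \<in> carrier K" "e \<in> carrier K" for a b d e
    using that CO_cocycle[OF c fx fx fx fx] by (simp add: app)
  have inv: "?p (g \<otimes>\<^bsub>K\<^esub> a, g \<otimes>\<^bsub>K\<^esub> b, g \<otimes>\<^bsub>K\<^esub> d) = ?p (a, b, d)"
    if k: "g \<in> carrier K" "a \<in> carrier K" "b \<in> carrier K" "d \<in> carrier K" for g a b d
  proof -
    have "f (g \<otimes>\<^bsub>K\<^esub> k) \<otimes>\<^bsub>G\<^esub> x = f g \<otimes>\<^bsub>G\<^esub> (f k \<otimes>\<^bsub>G\<^esub> x)" if "k \<in> carrier K" for k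
      using that k(1) x hom_mult[OF f] hom_in_carrier[OF f] by (simp add: G.m_assoc)
    then show ?thesis
      using k CO_left_invariant[OF c hom_in_carrier[OF f k(1)] fx fx fx] by (simp add: app)
  qed
  show ?thesis unfolding CO_def using ext zero cocycle inv by auto
qed

lemma class2_pullback_conj_ordering:
  assumes K: "group K" and G: "group G" and f: "f \<in> hom K G" and c: "c \<in> CO G"
    and fc: "pullback K f c \<in> CO K" and x: "x \<in> carrier G"
  shows "class2 K (cocycle_of K (pullback K f c)) =
    class2 K (cocycle_of K (pullback K f (conj_ordering G c x)))"
proof -
  interpret K: group K by fact
  interpret G: group G by fact
  let ?p = "pullback K f (conj_ordering G c x)"
  note p = pullback_conj_ordering_in_CO[OF assms]
  note f1 = hom_one[OF f K G]
  define d where "d k = prism G c x (f k) div 2" for k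
  have d: "2 * d k = prism G c x (f k)" if "k \<in> carrier K" for k
    unfolding d_def using even_prism[OF G c hom_in_carrier[OF f that] x] by simp
  show ?thesis
  proof (rule class2_eqI[OF K cocycle_of_cocycle[OF K fc] cocycle_of_cocycle[OF K p]])
    fix a b assume ab: "a \<in> carrier K" "b \<in> carrier K"
    then have ab': "a \<otimes>\<^bsub>K\<^esub> b \<in> carrier K" by simp
    have "2 * cocycle_of K ?p (a, b) - 2 * cocycle_of K (pullback K f c) (a, b) =
        pullback K f c (\<one>\<^bsub>K\<^esub>, a, a \<otimes>\<^bsub>K\<^esub> b) - ?p (\<one>\<^bsub>K\<^esub>, a, a \<otimes>\<^bsub>K\<^esub> b)"
      unfolding twice_cocycle_of[OF K p ab] twice_cocycle_of[OF K fc ab] by simp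
    also have "\<dots> = c (\<one>\<^bsub>G\<^esub>, f a, f a \<otimes>\<^bsub>G\<^esub> f b) - c (x, f a \<otimes>\<^bsub>G\<^esub> x, f a \<otimes>\<^bsub>G\<^esub> f b \<otimes>\<^bsub>G\<^esub> x)"
      unfolding pullback_conj_ordering_apply[OF f K.one_closed ab(1) ab']
      using ab ab' x by (simp add: pullback_def f1 hom_mult[OF f])
    also have "\<dots> = 2 * d b - 2 * d (a \<otimes>\<^bsub>K\<^esub> b) + 2 * d a"
      unfolding d[OF ab(1)] d[OF ab(2)] d[OF ab'] hom_mult[OF f ab]
      by (rule coboundary_prism[OF G c hom_in_carrier[OF f ab(1)] hom_in_carrier[OF f ab(2)] x, symmetric])
    finally show "cocycle_of K ?p (a, b) =
        cocycle_of K (pullback K f c) (a, b) + (d b - d (a \<otimes>\<^bsub>K\<^esub> b) + d a)"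
      by linarith
  qed
qed

lemma pullback_pullback:
  assumes "g \<in> hom H K"
  shows "pullback H g (pullback K f c) = pullback H (\<lambda>h. f (g h)) c"
  using hom_in_carrier[OF assms] by (auto simp: pullback_def fun_eq_iff)

lemma pullback_cong:
  assumes "\<And>h. h \<in> carrier H \<Longrightarrow> f h = g h"
  shows "pullback H f c = pullback H g c"
  using assms by (auto simp: pullback_def fun_eq_iff)

section \<open>The family of restricted translates\<close>

definition restricted_translates ::
  "('k, 'n) monoid_scheme \<Rightarrow> ('a, 'm) monoid_scheme \<Rightarrow> ('k \<Rightarrow> 'a) \<Rightarrow> ('a \<times> 'a \<times> 'a \<Rightarrow> int) \<Rightarrow>
     ('k \<times> 'k \<times> 'k \<Rightarrow> int) set" where
  "restricted_translates K G f c = (\<lambda>x. pullback K f (conj_ordering G c x)) ` carrier G"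

lemma pullback_in_restricted_translates:
  assumes "group G" "f \<in> hom K G"
  shows "pullback K f c \<in> restricted_translates K G f c"
proof -
  interpret G: group G by fact
  have "pullback K f c = pullback K f (conj_ordering G c \<one>\<^bsub>G\<^esub>)"
    using hom_in_carrier[OF assms(2)] by (auto simp: pullback_def conj_ordering_def fun_eq_iff)
  then show ?thesis unfolding restricted_translates_def by blast
qed

lemma conj_ordering_restricted_translate:
  assumes "group K" "group G" "f \<in> hom K G" "x \<in> carrier G" "h \<in> carrier K"
  shows "conj_ordering K (pullback K f (conj_ordering G c x)) h =
    pullback K f (conj_ordering G c (f h \<otimes>\<^bsub>G\<^esub> x))"
proof -
  interpret K: group K by fact
  interpret G: group G by fact
  show ?thesis
    using assms(4,5) hom_in_carrier[OF assms(3)]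
    by (auto simp: pullback_def conj_ordering_def fun_eq_iff hom_mult[OF assms(3)] G.m_assoc)
qed

lemma normal_restricted_translates:
  assumes "group K" "group G" "f \<in> hom K G" "c \<in> CO G" "pullback K f c \<in> CO K"
  shows "normal_family K (restricted_translates K G f c)"
  unfolding normal_family_def restricted_translates_def
proof (intro conjI ballI)
  interpret G: group G by fact
  fix k h assume k: "k \<in> (\<lambda>x. pullback K f (conj_ordering G c x)) ` carrier G" and h: "h \<in> carrier K"
  then obtain x where x: "x \<in> carrier G" "k = pullback K f (conj_ordering G c x)" by blast
  have "f h \<otimes>\<^bsub>G\<^esub> x \<in> carrier G" using x(1) hom_in_carrier[OF assms(3) h] by simp
  then show "conj_ordering K k h \<in> (\<lambda>x. pullback K f (conj_ordering G c x)) ` carrier G"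
    unfolding x(2) conj_ordering_restricted_translate[OF assms(1-3) x(1) h] by (rule imageI)
qed (use pullback_conj_ordering_in_CO[OF assms] in blast)

lemma cohomologically_constant_restricted_translates:
  assumes "group K" "group G" "f \<in> hom K G" "c \<in> CO G" "pullback K f c \<in> CO K"
  shows "cohomologically_constant K (restricted_translates K G f c)"
proof -
  have "class2 K (cocycle_of K k) = class2 K (cocycle_of K (pullback K f c))"
    if "k \<in> restricted_translates K G f c" for k
    using that class2_pullback_conj_ordering[OF assms] by (auto simp: restricted_translates_def)
  moreover have "restricted_translates K G f c \<subseteq> CO K"
    using normal_restricted_translates[OF assms] by (simp add: normal_family_def)
  ultimately show ?thesis by (simp add: cohomologically_constant_def)
qed

theorem proposition4p4:
  fixes I :: "'i set"
    and G :: "'i \<Rightarrow> ('a, 'm) monoid_scheme"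
    and H :: "('h, 'n) monoid_scheme"
    and \<phi> :: "'i \<Rightarrow> 'h \<Rightarrow> 'a"
    and cs :: "'i \<Rightarrow> 'a \<times> 'a \<times> 'a \<Rightarrow> int"
  assumes "\<And>i. i \<in> I \<Longrightarrow> group (G i)"
    and "\<And>i. i \<in> I \<Longrightarrow> cs i \<in> CO (G i)"
    and "group H"
    and "\<And>i. i \<in> I \<Longrightarrow> \<phi> i \<in> hom H (G i)"
    and "\<And>i. i \<in> I \<Longrightarrow> inj_on (\<phi> i) (carrier H)"
    and "\<exists>c \<in> CO (amalgam I G H \<phi>). extends_orderings I G H \<phi> c cs"
  shows "\<exists>R :: 'i \<Rightarrow> ('a \<times> 'a \<times> 'a \<Rightarrow> int) set.
    (\<forall>i \<in> I. R i \<subseteq> CO (G i) \<and> cohomologically_constant (G i) (R i) \<and>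
       normal_family (G i) (R i) \<and> cs i \<in> R i) \<and>
    compatible_orderings I H \<phi> cs \<and>
    compatible_families I H \<phi> R"
proof -
  interpret amalgam_data I G H \<phi> by (rule amalgam_data.intro[OF assms(1,4)])
  let ?A = "amalgam I G H \<phi>" and ?\<iota> = "amalgam_incl I G H \<phi>"
  obtain c where c: "c \<in> CO ?A" and "extends_orderings I G H \<phi> c cs" using assms(6) by blast
  then have res: "pullback (G i) (?\<iota> i) c = cs i" if "i \<in> I" for i
    using that by (simp add: extends_orderings_def)
  define R where "R i = restricted_translates (G i) ?A (?\<iota> i) c" for i
  have fam: "cohomologically_constant (G i) (R i)" "normal_family (G i) (R i)" "cs i \<in> R i"
    if i: "i \<in> I" for i
  proof -
    note hyps = gG[OF i] group_amalgam amalgam_incl_hom[OF i] c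
    have CO: "pullback (G i) (?\<iota> i) c \<in> CO (G i)" using res[OF i] assms(2)[OF i] by simp
    show "cohomologically_constant (G i) (R i)"
      unfolding R_def by (rule cohomologically_constant_restricted_translates[OF hyps CO])
    show "normal_family (G i) (R i)"
      unfolding R_def by (rule normal_restricted_translates[OF hyps CO])
    show "cs i \<in> R i"
      unfolding R_def res[OF i, symmetric] by (rule pullback_in_restricted_translates[OF hyps(2,3)])
  qed
  have glue: "pullback H (\<phi> i) (pullback (G i) (?\<iota> i) e) = pullback H (\<phi> j) (pullback (G j) (?\<iota> j) e)"
    if "i \<in> I" "j \<in> I" for i j e
    unfolding pullback_pullback[OF hp[OF that(1)]] pullback_pullback[OF hp[OF that(2)]]
    by (rule pullback_cong) (rule amalgam_incl_glue[OF that])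
  have "compatible_orderings I H \<phi> cs"
    unfolding compatible_orderings_def
  proof (intro ballI)
    fix i j assume "i \<in> I" "j \<in> I"
    then show "pullback H (\<phi> i) (cs i) = pullback H (\<phi> j) (cs j)"
      using glue[of i j c] by (simp only: res)
  qed
  moreover have "compatible_families I H \<phi> R"
    unfolding compatible_families_def R_def restricted_translates_def image_image
    by (intro ballI image_cong HOL.refl glue)
  moreover have "R i \<subseteq> CO (G i)" if "i \<in> I" for i
    using fam(2)[OF that] by (simp add: normal_family_def)
  ultimately show ?thesis using fam by blast
qed

end
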